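(* Let $n$ be a positive integer and let $A_1,A_2$ be elements of the poset $W(n)$. There is a comparability $A_1\prec A_2$ in $W(n)$ precisely when there are an $S$-block $[\alpha_1|\beta_1]\in A_1$ and an $S$-block $[\alpha_2|\beta_2]\in A_2$ for which $[\alpha_1|\beta_1]\prec[\alpha_2|\beta_2]$.
   Context: $Dis(n)$ is the set of partitions $\gamma=(g_1,\dots,g_r)$ of $n$ into distinct positive parts $g_1>\dots>g_r>0$, with $\mathrm{len}(\gamma)=r$; $Dis_k(n)$ is the subset of those with exactly $k$ parts. For $\gamma=(g_1,\dots,g_r)$ and $\delta=(d_1,\dots,d_s)$ in $Dis(n)$, $\delta\succeq\gamma$ ($\delta$ majorizes $\gamma$) means $\sum_{i=1}^m d_i\ge\sum_{i=1}^m g_i$ for all $m\le\min\{r,s\}$. An $S$-block is an ordered pair $[\alpha|\beta]$ with $\alpha,\beta\in Dis(n)$, $\beta\succeq\alpha$, and $\mathrm{len}(\alpha)\in\{\mathrm{len}(\beta),\mathrm{len}(\beta)+1\}$. $S\text{-}Block(n)$ is the poset of all such $S$-blocks, ordered by $[\alpha_1|\beta_1]\succeq[\alpha_2|\beta_2]$ iff $\alpha_1\succeq\alpha_2$ and $\beta_1\preceq\beta_2$; $\prec$ means $\preceq$ and not equal. For $n\ge\binom{k+1}{2}$: $A(n,k)$ is the set of $S$-blocks $[\alpha|\beta]$ with $\alpha,\beta\in Dis_k(n)$ ($k\ge1$); $A(n,k,k-1)$ is the set of $S$-blocks $[\alpha|\beta]$ with $\alpha\in Dis_k(n)$ and $\beta\in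 Dis_{k-1}(n)$ ($k\ge2$). The poset $W(n)$ has as elements the sets $A(n,k)$ ($k\ge1$, $\binom{k+1}{2}\le n$) and $A(n,k,k-1)$ ($k\ge2$, $\binom{k+1}{2}\le n$); its only comparabilities (between distinct elements) are $A(n,k,k-1)\prec A(n,k)$ and $A(n,k,k-1)\prec A(n,k-1)$.
   Formalization: The elements A_1 and A_2 of W(n) are taken to be distinct; for A_1 = A_2 the equivalence fails, e.g. n=5, A_1=A_2=A(5,2), where [(3,2)|(4,1)] ≺ [(3,2)|(3,2)] but A_1 ≺ A_1 is false. *)

theory Defs
  imports Main
begin

(* A partition into distinct positive parts is encoded as the strictly decreasing list of its parts,
   so len is the list length. *)
definition Dis :: "nat \<Rightarrow> nat list set" where
  "Dis n = {\<gamma>. sorted_wrt (>) \<gamma> \<and> (\<forall>g\<in>set \<gamma>. 0 < g) \<and> sum_list \<gamma> = n}"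

definition Dis_len :: "nat \<Rightarrow> nat \<Rightarrow> nat list set" where
  "Dis_len k n = {\<gamma> \<in> Dis n. length \<gamma> = k}"

definition majorizes :: "nat list \<Rightarrow> nat list \<Rightarrow> bool" where
  "majorizes \<delta> \<gamma> \<longleftrightarrow>
     (\<forall>m \<le> min (length \<gamma>) (length \<delta>). sum_list (take m \<gamma>) \<le> sum_list (take m \<delta>))"

type_synonym block = "nat list \<times> nat list"

definition S_Block :: "nat \<Rightarrow> block set" where
  "S_Block n = {(\<alpha>, \<beta>). \<alpha> \<in> Dis n \<and> \<beta> \<in> Dis n \<and> majorizes \<beta> \<alpha> \<and>
                 length \<alpha> \<in> {length \<beta>, length \<beta> + 1}}"

definition block_le :: "block \<Rightarrow> block \<Rightarrow> bool" where
  "block_le B1 B2 \<longleftrightarrow> majorizes (fst B2) (fst B1) \<and> majorizes (snd B1) (snd B2)"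

definition block_less :: "block \<Rightarrow> block \<Rightarrow> bool" where
  "block_less B1 B2 \<longleftrightarrow> block_le B1 B2 \<and> B1 \<noteq> B2"

definition A_equal :: "nat \<Rightarrow> nat \<Rightarrow> block set" where
  "A_equal n k = {(\<alpha>, \<beta>) \<in> S_Block n. \<alpha> \<in> Dis_len k n \<and> \<beta> \<in> Dis_len k n}"

(* A_step n k is A(n,k,k-1); the natural-number subtraction is harmless because
   this set is only used for k \<ge> 2. *)
definition A_step :: "nat \<Rightarrow> nat \<Rightarrow> block set" where
  "A_step n k = {(\<alpha>, \<beta>) \<in> S_Block n. \<alpha> \<in> Dis_len k n \<and> \<beta> \<in> Dis_len (k - 1) n}"

definition W :: "nat \<Rightarrow> block set set" where
  "W n = {A_equal n k | k. 1 \<le> k \<and> (k + 1) choose 2 \<le> n}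
       \<union> {A_step n k | k. 2 \<le> k \<and> (k + 1) choose 2 \<le> n}"

definition W_le :: "nat \<Rightarrow> block set \<Rightarrow> block set \<Rightarrow> bool" where
  "W_le n A1 A2 \<longleftrightarrow> A1 \<in> W n \<and> A2 \<in> W n \<and>
     (A1 = A2 \<or>
      (\<exists>k. 2 \<le> k \<and> (k + 1) choose 2 \<le> n \<and>
           A1 = A_step n k \<and> (A2 = A_equal n k \<or> A2 = A_equal n (k - 1))))"

definition W_less :: "nat \<Rightarrow> block set \<Rightarrow> block set \<Rightarrow> bool" where
  "W_less n A1 A2 \<longleftrightarrow> W_le n A1 A2 \<and> A1 \<noteq> A2"

end

theory Submission
  imports Defs
begin

text \<open>
  Along the majorization order the number of parts can only drop: a partition with more parts
  than \<open>\<gamma>\<close> has not yet used up its whole sum after \<open>length \<gamma>\<close> parts, so it cannot majorize \<open>\<gamma>\<close>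
  (lemma \<open>majorizes_length_le\<close>). Hence a comparability
  \<open>[\<alpha>\<^sub>1|\<beta>\<^sub>1] \<preceq> [\<alpha>\<^sub>2|\<beta>\<^sub>2]\<close> of blocks gives the chain
  \<open>len \<beta>\<^sub>1 \<le> len \<beta>\<^sub>2 \<le> len \<alpha>\<^sub>2 \<le> len \<alpha>\<^sub>1 \<le> len \<beta>\<^sub>1 + 1\<close>.
  If \<open>len \<alpha>\<^sub>1 = len \<beta>\<^sub>1\<close>, all four lengths agree and the two blocks lie in the same class. If
  \<open>len \<alpha>\<^sub>1 = k = len \<beta>\<^sub>1 + 1\<close>, the second block can only lie in \<open>A(n,k,k-1)\<close>, \<open>A(n,k)\<close> or
  \<open>A(n,k-1)\<close>. These are exactly the comparabilities of \<open>W(n)\<close>.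

  Conversely, every comparability of \<open>W(n)\<close> is witnessed by a single pair: if \<open>\<alpha>\<close> has \<open>k\<close> parts,
  \<open>\<beta>\<close> has \<open>k - 1\<close> parts and \<open>\<beta> \<succeq> \<alpha>\<close>, then the block \<open>[\<alpha>|\<beta>]\<close> lies strictly below both
  \<open>[\<alpha>|\<alpha>]\<close> and \<open>[\<beta>|\<beta>]\<close>. Such a pair arises by adding the smallest part of \<open>\<alpha>\<close> to its largest
  part (lemma \<open>Dis_merge_ends\<close>), where \<open>\<alpha>\<close> is any partition with \<open>k\<close> distinct parts; one exists
  as soon as \<open>1 + \<dots> + k \<le> n\<close>.
\<close>

lemma majorizes_refl: "majorizes \<gamma> \<gamma>"
  by (simp add: majorizes_def)

lemma majorizes_length_le:
  assumes "\<gamma> \<in> Dis n" "\<delta> \<in> Dis n" "majorizes \<delta> \<gamma>"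
  shows "length \<delta> \<le> length \<gamma>"
proof (rule ccontr)
  let ?r = "length \<gamma>"
  assume "\<not> length \<delta> \<le> ?r"
  then have long: "?r < length \<delta>" by simp
  with \<open>majorizes \<delta> \<gamma>\<close> have "sum_list (take ?r \<gamma>) \<le> sum_list (take ?r \<delta>)"
    unfolding majorizes_def by (metis less_imp_le min.absorb1 order_refl)
  then have "n \<le> sum_list (take ?r \<delta>)"
    using \<open>\<gamma> \<in> Dis n\<close> by (simp add: Dis_def)
  moreover have "sum_list (take ?r \<delta>) + sum_list (drop ?r \<delta>) = n"
    using \<open>\<delta> \<in> Dis n\<close> by (simp add: Dis_def flip: sum_list_append)
  moreover have "drop ?r \<delta> = \<delta> ! ?r # drop (Suc ?r) \<delta>"
    using long by (simp add: Cons_nth_drop_Suc)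
  moreover have "0 < \<delta> ! ?r"
    using \<open>\<delta> \<in> Dis n\<close> long by (auto simp: Dis_def)
  ultimately show False by simp
qed

lemma block_le_length_chain:
  assumes "(\<alpha>\<^sub>1, \<beta>\<^sub>1) \<in> S_Block n" "(\<alpha>\<^sub>2, \<beta>\<^sub>2) \<in> S_Block n"
    and "block_le (\<alpha>\<^sub>1, \<beta>\<^sub>1) (\<alpha>\<^sub>2, \<beta>\<^sub>2)"
  shows "length \<beta>\<^sub>1 \<le> length \<beta>\<^sub>2" "length \<beta>\<^sub>2 \<le> length \<alpha>\<^sub>2" "length \<alpha>\<^sub>2 \<le> length \<alpha>\<^sub>1"
  using assms by (auto simp: S_Block_def block_le_def intro: majorizes_length_le)

lemma Dis_merge_ends:
  assumes "g # xs @ [x] \<in> Dis n"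
  shows "(g + x) # xs \<in> Dis n" "majorizes ((g + x) # xs) (g # xs @ [x])"
proof -
  show "(g + x) # xs \<in> Dis n"
    using assms by (auto simp: Dis_def sorted_wrt_append intro: trans_less_add1)
  have "sum_list (take m (g # xs @ [x])) \<le> sum_list (take m ((g + x) # xs))"
    if "m \<le> Suc (length xs)" for m
    using that by (cases m) auto
  then show "majorizes ((g + x) # xs) (g # xs @ [x])"
    by (auto simp: majorizes_def)
qed

lemma sum_list_staircase: "sum_list (rev [1..<k]) = k choose 2"
  by (induction k) (auto simp: numeral_2_eq_2)

text \<open>
  The partition \<open>(n - (1 + \<dots> + (k - 1)), k - 1, \<dots>, 2, 1)\<close>, which puts all the excess over the
  staircase into the largest part.
\<close>

lemma Dis_staircase:
  assumes "1 \<le> k" "(k + 1) choose 2 \<le> n"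
  shows "(n - (k choose 2)) # rev [1..<k] \<in> Dis n"
proof -
  have "k + (k choose 2) \<le> n"
    using assms by (simp add: numeral_2_eq_2)
  moreover have "sorted_wrt (>) (rev [1..<k])"
    by (simp add: sorted_wrt_rev)
  ultimately show ?thesis
    using sum_list_staircase[of k] \<open>1 \<le> k\<close> by (auto simp: Dis_def)
qed

lemma exists_length_dropping_block:
  assumes "2 \<le> k" "(k + 1) choose 2 \<le> n"
  obtains \<alpha> \<beta> where "\<alpha> \<in> Dis_len k n" "\<beta> \<in> Dis_len (k - 1) n" "majorizes \<beta> \<alpha>"
proof -
  let ?g = "n - (k choose 2)"
  have "[1..<k] = 1 # [2..<k]"
    using \<open>2 \<le> k\<close> by (simp add: upt_conv_Cons numeral_2_eq_2)
  then have "?g # rev [2..<k] @ [1] \<in> Dis n"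
    using Dis_staircase[of k n] assms by simp
  with Dis_merge_ends[OF this] \<open>2 \<le> k\<close> show ?thesis
    by (intro that[of "?g # rev [2..<k] @ [1]" "(?g + 1) # rev [2..<k]"])
       (auto simp: Dis_len_def)
qed

theorem corollary4p17:
  fixes n :: nat and A1 A2 :: "block set"
  assumes "0 < n"
    and "A1 \<in> W n"
    and "A2 \<in> W n"
    and "A1 \<noteq> A2"
  shows "W_less n A1 A2 \<longleftrightarrow> (\<exists>B1\<in>A1. \<exists>B2\<in>A2. block_less B1 B2)"
proof
  assume "W_less n A1 A2"
  then obtain k where k: "2 \<le> k" "(k + 1) choose 2 \<le> n" "A1 = A_step n k"
    and A2: "A2 = A_equal n k \<or> A2 = A_equal n (k - 1)"
    unfolding W_less_def W_le_def by blast
  obtain \<alpha> \<beta> where ab: "\<alpha> \<in> Dis_len k n" "\<beta> \<in> Dis_len (k - 1) n" "majorizes \<beta> \<alpha>"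
    using exists_length_dropping_block k(1,2) by blast
  then have "\<alpha> \<noteq> \<beta>" and low: "(\<alpha>, \<beta>) \<in> A1"
    using k by (auto simp: Dis_len_def A_step_def S_Block_def)
  have "(\<alpha>, \<alpha>) \<in> A_equal n k" "(\<beta>, \<beta>) \<in> A_equal n (k - 1)"
    using ab by (auto simp: A_equal_def S_Block_def Dis_len_def majorizes_refl)
  moreover have "block_less (\<alpha>, \<beta>) (\<alpha>, \<alpha>)" "block_less (\<alpha>, \<beta>) (\<beta>, \<beta>)"
    using ab \<open>\<alpha> \<noteq> \<beta>\<close> by (auto simp: block_less_def block_le_def majorizes_refl)
  ultimately show "\<exists>B1\<in>A1. \<exists>B2\<in>A2. block_less B1 B2"
    using low A2 by blast
next
  assume "\<exists>B1\<in>A1. \<exists>B2\<in>A2. block_less B1 B2"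
  then obtain \<alpha>\<^sub>1 \<beta>\<^sub>1 \<alpha>\<^sub>2 \<beta>\<^sub>2 where mem: "(\<alpha>\<^sub>1, \<beta>\<^sub>1) \<in> A1" "(\<alpha>\<^sub>2, \<beta>\<^sub>2) \<in> A2"
    and le: "block_le (\<alpha>\<^sub>1, \<beta>\<^sub>1) (\<alpha>\<^sub>2, \<beta>\<^sub>2)"
    by (auto simp: block_less_def)
  have blocks: "(\<alpha>\<^sub>1, \<beta>\<^sub>1) \<in> S_Block n" "(\<alpha>\<^sub>2, \<beta>\<^sub>2) \<in> S_Block n"
    using mem assms by (auto simp: W_def A_equal_def A_step_def)
  note chain = block_le_length_chain[OF blocks le]
  have A2_cases: "A2 = A_equal n (length \<alpha>\<^sub>2) \<and> length \<beta>\<^sub>2 = length \<alpha>\<^sub>2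
      \<or> A2 = A_step n (length \<alpha>\<^sub>2) \<and> length \<alpha>\<^sub>2 = length \<beta>\<^sub>2 + 1"
    using mem assms(3) by (auto simp: W_def A_equal_def A_step_def Dis_len_def)
  from \<open>A1 \<in> W n\<close> consider
      (equal) k where "A1 = A_equal n k"
    | (step) k where "2 \<le> k" "(k + 1) choose 2 \<le> n" "A1 = A_step n k"
    unfolding W_def by blast
  then show "W_less n A1 A2"
  proof cases
    case equal
    with mem have "length \<alpha>\<^sub>1 = k" "length \<beta>\<^sub>1 = k"
      by (auto simp: A_equal_def Dis_len_def)
    with chain have "length \<alpha>\<^sub>2 = k" "length \<beta>\<^sub>2 = k" by auto
    with A2_cases equal \<open>A1 \<noteq> A2\<close> show ?thesis by auto
  next
    case step
    with mem have "length \<alpha>\<^sub>1 = k" "length \<beta>\<^sub>1 = k - 1"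
      by (auto simp: A_step_def Dis_len_def)
    with chain have "k - 1 \<le> length \<beta>\<^sub>2" "length \<beta>\<^sub>2 \<le> length \<alpha>\<^sub>2" "length \<alpha>\<^sub>2 \<le> k" by auto
    then have "length \<alpha>\<^sub>2 = k \<or> length \<alpha>\<^sub>2 = k - 1 \<and> length \<beta>\<^sub>2 = k - 1"
      by auto
    with A2_cases step \<open>A1 \<noteq> A2\<close> have "A2 = A_equal n k \<or> A2 = A_equal n (k - 1)"
      by auto
    with step assms show ?thesis
      unfolding W_less_def W_le_def by blast
  qed
qed

end
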